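(* Let $K>0$, $k=1/K$, and let $\Lambda_K^{(3)}$ be a random variable with probability density $t\mapsto 3K^2r_K^{(3)}(t)$ on $\mathbb{R}_+$, where $r_K^{(3)}(t)=E_1^{(3)}\big[\big(\tfrac{1}{X_t}-K\big)^+\big]$. Then the Laplace transform of $\Lambda_K^{(3)}$ is, for $\lambda>0$, $$E\left[\exp(-\lambda\Lambda_K^{(3)})\right]=\frac{3}{\lambda k^2}\,e^{-\sqrt{2\lambda}}\left(\frac{\sinh(\sqrt{2\lambda}\,k)}{\sqrt{2\lambda}\,k}-1\right).$$
   Context: $P_x^{(3)}$ (with expectation $E_x^{(3)}$) is the law on $C(\mathbb{R}_+,\mathbb{R}_+)$ of the Bessel process of dimension $3$ started at $x\ge 0$, i.e. the law of the Euclidean norm of a standard 3-dimensional Brownian motion started at a point of norm $x$; $(X_t)_{t\ge0}$ is the canonical process. $a^+=\max(a,0)$. The paper asserts that $3K^2r_K^{(3)}$ is a probability density on $\mathbb{R}_+$, and $\Lambda_K^{(3)}$ denotes a random variable with this density. *)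

theory Defs
  imports "HOL-Probability.Probability"
begin

text \<open>
  Standard \<^emph>\<open>n\<close>-dimensional Brownian motion started at \<open>z\<close>, with \<open>n = CARD('n)\<close>.
  The product of one-dimensional normal densities is the density of \<open>N(0, (t - s) I)\<close>.
  Only times \<open>t \<ge> 0\<close> matter.
\<close>

definition brownian_motion ::
    "'a measure \<Rightarrow> (real \<Rightarrow> 'a \<Rightarrow> real ^ 'n::finite) \<Rightarrow> real ^ 'n \<Rightarrow> bool" where
  "brownian_motion M B z \<longleftrightarrow>
     prob_space M \<and>
     (\<forall>t\<ge>0. B t \<in> borel_measurable M) \<and>
     (AE \<omega> in M. B 0 \<omega> = z) \<and>
     (\<forall>\<omega>\<in>space M. continuous_on {0..} (\<lambda>t. B t \<omega>)) \<and>
     (\<forall>(\<tau> :: nat \<Rightarrow> real) n. 0 \<le> \<tau> 0 \<and> strict_mono \<tau> \<longrightarrow>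
        prob_space.indep_vars M (\<lambda>_. borel) (\<lambda>i \<omega>. B (\<tau> (Suc i)) \<omega> - B (\<tau> i) \<omega>) {..<n}) \<and>
     (\<forall>s t. 0 \<le> s \<and> s < t \<longrightarrow>
        distributed M lborel (\<lambda>\<omega>. B t \<omega> - B s \<omega>)
          (\<lambda>x. ennreal (\<Prod>i\<in>UNIV. normal_density 0 (sqrt (t - s)) (x $ i))))"

text \<open>
  The path space \<open>C(\<real>\<^sub>+, \<real>\<^sub>+)\<close> with the sigma-algebra generated by the coordinate maps.
  A path is represented by a function that is \<^const>\<open>undefined\<close> at negative times.
\<close>

definition path_space :: "(real \<Rightarrow> real) measure" where
  "path_space = restrict_space (\<Pi>\<^sub>M t\<in>{0..}. borel)
     {w. continuous_on {0..} w \<and> (\<forall>t\<ge>0. 0 \<le> w t)}"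

text \<open>
  \<open>bessel3_law x P\<close> says that \<open>P\<close> is the law of the three-dimensional Bessel process started
  at \<open>x\<close>. Fixing the type of the sample space is no restriction: every three-dimensional Brownian
  motion can be transported to the space of its own paths without changing the law of its norm.
\<close>

definition bessel3_law :: "real \<Rightarrow> (real \<Rightarrow> real) measure \<Rightarrow> bool" where
  "bessel3_law x P \<longleftrightarrow>
     (\<exists>(M :: (real \<Rightarrow> real ^ 3) measure) B (z :: real ^ 3).
        brownian_motion M B z \<and> norm z = x \<and>
        P = distr M path_space (\<lambda>\<omega>. \<lambda>t\<in>{0..}. norm (B t \<omega>)))"

lemma measurable_norm_path:
  fixes B :: "real \<Rightarrow> 'a \<Rightarrow> real ^ 'n::finite"
  assumes "brownian_motion M B z"
  shows "(\<lambda>\<omega>. \<lambda>t\<in>{0..}. norm (B t \<omega>)) \<in> measurable M path_space"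
proof -
  have meas: "B t \<in> borel_measurable M" if "0 \<le> t" for t
    using assms that by (simp add: brownian_motion_def)
  have cont: "continuous_on {0..} (\<lambda>t. B t \<omega>)" if "\<omega> \<in> space M" for \<omega>
    using assms that by (simp add: brownian_motion_def)
  have "(\<lambda>\<omega>. \<lambda>t\<in>{0..}. norm (B t \<omega>)) \<in> measurable M (\<Pi>\<^sub>M t\<in>{0..}. borel)"
    by (rule measurable_restrict) (use meas in auto)
  moreover have "continuous_on {0..} (\<lambda>t\<in>{0..}. norm (B t \<omega>))" if "\<omega> \<in> space M" for \<omega>
    using continuous_on_norm[OF cont[OF that]]
    by (rule continuous_on_eq) simp
  ultimately show ?thesis
    unfolding path_space_def by (intro measurable_restrict_space2) auto
qed

lemma prob_space_bessel3_law:
  assumes "bessel3_law x P"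
  shows "prob_space P"
proof -
  obtain M :: "(real \<Rightarrow> real ^ 3) measure" and B and z :: "real ^ 3"
    where B: "brownian_motion M B z"
      and P: "P = distr M path_space (\<lambda>\<omega>. \<lambda>t\<in>{0..}. norm (B t \<omega>))"
    using assms unfolding bessel3_law_def by blast
  from B have "prob_space M"
    by (simp add: brownian_motion_def)
  then show ?thesis
    unfolding P by (rule prob_space.prob_space_distr) (rule measurable_norm_path[OF B])
qed

text \<open>
  The integrand uses \<open>1 / 0 = 0\<close> instead of \<open>1 / 0 = \<infinity>\<close>; a Bessel process of dimension 3
  started at 1 almost surely does not vanish at a fixed time, so the expectation is unaffected.
\<close>

definition bessel_r :: "(real \<Rightarrow> real) measure \<Rightarrow> real \<Rightarrow> real \<Rightarrow> real" where
  "bessel_r P K t = (\<integral>X. max (1 / X t - K) 0 \<partial>P)"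

end

theory Submission
  imports Defs "HOL-Real_Asymp.Real_Asymp"
begin

text \<open>
  Integrating the Gaussian density over the spheres around the origin shows that the radial part
  at time \<open>t\<close> has density \<open>r (n\<^sub>t(1 - r) - n\<^sub>t(1 + r))\<close>, with \<open>n\<^sub>t\<close> the centred normal
  density of variance \<open>t\<close>; this is the \<open>h\<close>-transform, with \<open>h(r) = r\<close>, of the transition density
  of Brownian motion killed at 0. The factor \<open>r\<close> cancels the singularity of the payoff, so
  \<open>r_K(t)\<close> is the integral of \<open>(1 - K r) (n\<^sub>t(1 - r) - n\<^sub>t(1 + r))\<close> over \<open>0 < r < k\<close>.
  By Tonelli, with \<open>s = sqrt (2 \<lambda>)\<close>, its Laplace transform is the integral of
  \<open>(1 - K r) (e^(-s |1 - r|) - e^(-s (1 + r))) / s\<close>. For \<open>k \<le> 1\<close> the resolvent is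
  \<open>2 e^(-s) sinh(s r) / s\<close> and the integral is elementary; for \<open>k > 1\<close> the total mass is less
  than 1, which contradicts the assumption that \<open>3 K\<^sup>2 r_K\<close> is a probability density.
\<close>

section \<open>Lebesgue measure on \<open>real ^ 3\<close> in axial and radial coordinates\<close>

text \<open>The half-lines are closed under intersection and generate the Borel sets, and those with
  natural endpoints exhaust the line. Infinite total mass is allowed, since the lemma is applied to
  a pushforward of \<open>lborel\<close>.\<close>

lemma measure_eqI_atMost:
  fixes M N :: "real measure"
  assumes sets: "sets M = sets borel" "sets N = sets borel"
    and fin: "\<And>x. emeasure M {..x} < \<infinity>"
    and eq: "\<And>x. emeasure M {..x} = emeasure N {..x}"
  shows "M = N"
proof (rule measure_eqI_generator_eq)
  let ?E = "range (\<lambda>a::real. {..a})"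
  show "Int_stable ?E"
    by (auto simp: Int_stable_def)
  show "?E \<subseteq> Pow UNIV" "sets M = sigma_sets UNIV ?E" "sets N = sigma_sets UNIV ?E"
    unfolding sets borel_eq_atMost by auto
  show "range (\<lambda>n::nat. {..real n}) \<subseteq> ?E" by auto
  show "(\<Union>n::nat. {..real n}) = UNIV"
    by (auto simp: real_arch_simple)
  show "emeasure M {..real n} \<noteq> \<infinity>" for n using fin[of "real n"] by simp
  show "emeasure M X = emeasure N X" if "X \<in> ?E" for X using that eq by auto
qed

text \<open>The sublevel set at \<open>x\<close> is a disc of area
  \<open>pi * (x\<^sup>2 - a\<^sup>2)\<close>, whose derivative in \<open>x\<close> is
  \<open>2 * pi * x\<close>. Thus \<open>a\<close> enters the density only through its support: on a
  sphere the axial coordinate is uniformly distributed (Archimedes).\<close>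

lemma distr_lborel_sqrt_shifted_norm:
  fixes a :: real
  shows "distr lborel borel (\<lambda>p :: real \<times> real. sqrt (a\<^sup>2 + (norm p)\<^sup>2)) =
    density lborel (\<lambda>r. ennreal (2 * pi * r) * indicator {\<bar>a\<bar><..} r)"
    (is "distr _ _ ?f = density _ ?d")
proof (rule measure_eqI_atMost)
  fix x :: real
  have meas [measurable]: "?f \<in> borel_measurable borel"
    by (intro borel_measurable_continuous_onI continuous_intros)
  have L: "emeasure (distr lborel borel ?f) {..x} = ennreal (pi * (x\<^sup>2 - a\<^sup>2)) * indicator {\<bar>a\<bar>..} x"
  proof (cases "\<bar>a\<bar> \<le> x")
    case True
    then have x: "0 \<le> x" and ax: "a\<^sup>2 \<le> x\<^sup>2"
      by (auto intro: order_trans[OF abs_ge_zero] power2_le_iff_abs_le[THEN iffD2] simp: abs_le_square_iff)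
    have "?f p \<le> x \<longleftrightarrow> norm p \<le> sqrt (x\<^sup>2 - a\<^sup>2)" for p
    proof -
      have "?f p \<le> x \<longleftrightarrow> a\<^sup>2 + (norm p)\<^sup>2 \<le> x\<^sup>2"
        using x by (simp add: real_sqrt_le_iff' )
      also have "\<dots> \<longleftrightarrow> norm p \<le> sqrt (x\<^sup>2 - a\<^sup>2)"
        using real_le_rsqrt[of "norm p" "x\<^sup>2 - a\<^sup>2"] sqrt_ge_absD[of "norm p" "x\<^sup>2 - a\<^sup>2"] by auto
      finally show ?thesis .
    qed
    then have "?f -` {..x} = cball 0 (sqrt (x\<^sup>2 - a\<^sup>2))"
      by auto
    then show ?thesis
      using True ax by (simp add: emeasure_distr emeasure_cball unit_ball_vol_2)
  next
    case False
    have "\<bar>a\<bar> \<le> ?f p" for p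
      by (rule real_le_rsqrt) simp
    then have "\<not> ?f p \<le> x" for p
      using False order_trans by blast
    then have "?f -` {..x} = {}" by auto
    with False show ?thesis
      by (simp add: emeasure_distr)
  qed
  then show "emeasure (distr lborel borel ?f) {..x} < \<infinity>"
    by (simp add: ennreal_mult_less_top indicator_def)
  have "emeasure (density lborel ?d) {..x} =
      (\<integral>\<^sup>+r. ennreal (2 * pi * r) * indicator {\<bar>a\<bar><..} r * indicator {..x} r \<partial>lborel)"
    by (subst emeasure_density) auto
  also have "\<dots> = (\<integral>\<^sup>+r. ennreal (2 * pi * r) * indicator {\<bar>a\<bar>..x} r \<partial>lborel)"
    by (rule nn_integral_cong_AE, rule AE_mp[OF AE_lborel_singleton[of "\<bar>a\<bar>"]])
       (auto split: split_indicator)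
  also have "\<dots> = ennreal (pi * (x\<^sup>2 - a\<^sup>2)) * indicator {\<bar>a\<bar>..} x"
  proof (cases "\<bar>a\<bar> \<le> x")
    case True
    have "(\<integral>\<^sup>+r. ennreal (2 * pi * r) * indicator {\<bar>a\<bar>..x} r \<partial>lborel) =
        ennreal (pi * x\<^sup>2 - pi * \<bar>a\<bar>\<^sup>2)"
      by (rule nn_integral_FTC_Icc[OF _ _ _ True])
         (auto intro!: derivative_eq_intros simp: has_real_derivative_iff_has_vector_derivative[symmetric])
    then show ?thesis using True by (simp add: algebra_simps)
  qed auto
  finally show "emeasure (distr lborel borel ?f) {..x} = emeasure (density lborel ?d) {..x}"
    using L by simp
qed auto

text \<open>The preimage of a box is its image under the inverse, which is again orthogonal and
  preserves Lebesgue measure. The preimage is Borel, so \<open>lborel\<close> and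
  \<open>lebesgue\<close> agree on it.\<close>

lemma distr_lborel_orthogonal_transformation:
  fixes f :: "real ^ 'n::{finite,wellorder} \<Rightarrow> real ^ 'n::_"
  assumes f: "orthogonal_transformation f"
  shows "distr lborel borel f = lborel"
proof (rule lborel_eqI[symmetric])
  from f have lin: "linear f" and bij: "bij f"
    by (auto simp: orthogonal_transformation_linear orthogonal_transformation_bij)
  then have [measurable]: "f \<in> borel_measurable borel"
    by (intro borel_measurable_continuous_onI linear_continuous_on)
       (simp add: linear_conv_bounded_linear)
  have inv: "orthogonal_transformation (inv f)"
    using f by (rule orthogonal_transformation_inv)
  fix l u :: "real ^ 'n::_"
  assume lu: "\<And>b. b \<in> Basis \<Longrightarrow> l \<bullet> b \<le> u \<bullet> b"
  have "f -` box l u = inv f ` box l u"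
    using bij by (rule bij_vimage_eq_inv_image)
  moreover have "inv f ` box l u \<in> lmeasurable"
      "measure lebesgue (inv f ` box l u) = measure lebesgue (box l u)"
    using measurable_orthogonal_image[OF inv] measure_orthogonal_image[OF inv] by auto
  ultimately have S: "f -` box l u \<in> lmeasurable"
    and eq: "measure lebesgue (f -` box l u) = measure lebesgue (box l u)"
    by simp_all
  have "f -` box l u \<in> sets borel"
    using measurable_sets[of f borel borel "box l u"] by simp
  then have "emeasure lborel (f -` box l u) = emeasure lebesgue (f -` box l u)"
    by (simp add: emeasure_completion)
  also have "\<dots> = ennreal (measure lebesgue (f -` box l u))"
    using S by (simp add: emeasure_eq_measure2)
  finally have "emeasure lborel (f -` box l u) = ennreal (measure lebesgue (box l u))"
    using eq by simp
  then show "emeasure (distr lborel borel f) (box l u) = (\<Prod>b\<in>Basis. (u - l) \<bullet> b)"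
    using lu by (simp add: emeasure_distr)
qed simp

text \<open>Identifies \<open>real ^ 3\<close> with an iterated product, so that Tonelli can
  separate the first coordinate from the other two.\<close>

lemma distr_lborel_axis_3:
  "distr lborel borel (\<lambda>p. fst p *\<^sub>R axis 1 1 + fst (snd p) *\<^sub>R axis 2 1 + snd (snd p) *\<^sub>R axis 3 1) =
    (lborel :: (real ^ 3) measure)"
proof (rule lborel_eqI[symmetric])
  let ?f = "\<lambda>p. fst p *\<^sub>R axis 1 1 + fst (snd p) *\<^sub>R axis 2 1 + snd (snd p) *\<^sub>R axis 3 1 :: real ^ 3"
  have [measurable]: "?f \<in> borel_measurable borel"
    by (intro borel_measurable_continuous_onI continuous_intros)
  fix l u :: "real ^ 3"
  assume "\<And>b. b \<in> Basis \<Longrightarrow> l \<bullet> b \<le> u \<bullet> b"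
  then have lu: "l $ i \<le> u $ i" for i
    by (metis axis_in_Basis_iff Basis_real_def cart_eq_inner_axis insertI1)
  have axis: "axis i (1::real) $ j = (if i = j then 1 else 0)" for i j :: 3
    by (simp add: axis_def)
  have "?f -` box l u = box (l $ 1, l $ 2, l $ 3) (u $ 1, u $ 2, u $ 3)"
    by (auto simp: mem_box_cart forall_3 mem_box Basis_prod_def axis)
  moreover have "(\<Prod>b\<in>Basis. (u - l) \<bullet> b) = (u $ 1 - l $ 1) * (u $ 2 - l $ 2) * (u $ 3 - l $ 3)"
  proof -
    have B: "Basis = {axis 1 1, axis 2 1, axis 3 (1::real) :: real ^ 3}"
      unfolding Basis_vec_def by auto (metis exhaust_3)
    have "axis 1 1 \<noteq> (axis 2 1 :: real ^ 3)" "axis 1 1 \<noteq> (axis 3 1 :: real ^ 3)"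
        "axis 2 1 \<noteq> (axis 3 1 :: real ^ 3)"
      by (auto simp: axis_eq_axis)
    then show ?thesis
      unfolding B by (simp add: inner_axis mult.assoc)
  qed
  moreover have "emeasure lborel (box (l $ 1, l $ 2, l $ 3) (u $ 1, u $ 2, u $ 3)) =
      ennreal ((u $ 1 - l $ 1) * (u $ 2 - l $ 2) * (u $ 3 - l $ 3))"
    using lu by (subst emeasure_lborel_box) (auto simp: Basis_prod_def prod.union_disjoint)
  ultimately show "emeasure (distr lborel borel ?f) (box l u) = (\<Prod>b\<in>Basis. (u - l) \<bullet> b)"
    by (simp add: emeasure_distr)
qed simp

text \<open>A rotation moves \<open>z\<close> to the first axis, which turns
  \<open>z \<bullet> w\<close> into the first coordinate \<open>a\<close>. The other two coordinates
  then enter only through the norm of a planar point, and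
  \<open>distr_lborel_sqrt_shifted_norm\<close> replaces them by \<open>r\<close>.\<close>

lemma nn_integral_radial_axial:
  fixes z :: "real ^ 3"
  assumes z: "norm z = 1"
    and h [measurable]: "case_prod h \<in> borel_measurable borel"
  shows "(\<integral>\<^sup>+w. h (z \<bullet> w) (norm w) \<partial>lborel) =
    (\<integral>\<^sup>+a. (\<integral>\<^sup>+r. h a r * ennreal (2 * pi * r) * indicator {\<bar>a\<bar><..} r \<partial>lborel) \<partial>lborel)"
proof -
  obtain f :: "real ^ 3 \<Rightarrow> real ^ 3" where f: "orthogonal_transformation f" and fz: "f (axis 1 1) = z"
    using orthogonal_transformation_exists_1[of "axis 1 1" z] z by auto
  let ?g = "\<lambda>p. fst p *\<^sub>R axis 1 1 + fst (snd p) *\<^sub>R axis 2 1 + snd (snd p) *\<^sub>R axis 3 1 :: real ^ 3"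
  have [measurable]: "?g \<in> borel_measurable borel"
    by (intro borel_measurable_continuous_onI continuous_intros)
  have [measurable]: "f \<in> borel_measurable borel"
    using orthogonal_transformation_linear[OF f]
    by (intro borel_measurable_continuous_onI linear_continuous_on)
       (simp add: linear_conv_bounded_linear)
  \<comment> \<open>Joint measurability of \<open>h\<close>, restated as a composition rule for the
    changes of variables below.\<close>
  have h': "(\<lambda>x. h (u x) (v x)) \<in> borel_measurable N"
    if "u \<in> borel_measurable N" "v \<in> borel_measurable N" for u v and N :: "'b measure"
    using measurable_compose[OF measurable_Pair[OF that] h[unfolded borel_prod[symmetric]]] by simp
  have zf: "z \<bullet> f w = w $ 1" "norm (f w) = norm w" for w
    using f unfolding fz[symmetric]
    by (auto simp: orthogonal_transformation_def orthogonal_transformation_norm inner_axis')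
  have "(\<integral>\<^sup>+w. h (z \<bullet> w) (norm w) \<partial>lborel) = (\<integral>\<^sup>+w. h (z \<bullet> w) (norm w) \<partial>distr lborel borel f)"
    by (simp only: distr_lborel_orthogonal_transformation[OF f])
  also have "\<dots> = (\<integral>\<^sup>+(w :: real ^ 3). h (w $ 1) (norm w) \<partial>lborel)"
    by (subst nn_integral_distr) (auto intro!: h' simp: zf)
  also have "\<dots> = (\<integral>\<^sup>+(w :: real ^ 3). h (w $ 1) (norm w) \<partial>distr lborel borel ?g)"
    by (simp only: distr_lborel_axis_3)
  also have "\<dots> = (\<integral>\<^sup>+p. h (?g p $ 1) (norm (?g p)) \<partial>lborel)"
    by (subst nn_integral_distr) (auto intro!: h')
  also have "\<dots> = (\<integral>\<^sup>+(p :: real \<times> real \<times> real). h (fst p) (sqrt ((fst p)\<^sup>2 + (norm (snd p))\<^sup>2)) \<partial>lborel)"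
    by (intro nn_integral_cong)
       (simp add: axis_def norm_vec_def L2_set_def sum_3 norm_prod_def add.assoc)
  also have "\<dots> = (\<integral>\<^sup>+a. (\<integral>\<^sup>+(p :: real \<times> real). h a (sqrt (a\<^sup>2 + (norm p)\<^sup>2)) \<partial>lborel) \<partial>lborel)"
  proof -
    have "(\<lambda>p :: real \<times> real \<times> real. h (fst p) (sqrt ((fst p)\<^sup>2 + (norm (snd p))\<^sup>2)))
        \<in> borel_measurable (lborel \<Otimes>\<^sub>M lborel)"
      unfolding lborel_prod
      by (rule h'; simp; intro borel_measurable_continuous_onI continuous_intros)
    from lborel.nn_integral_fst[OF this] show ?thesis
      by (simp add: lborel_prod)
  qed
  also have "\<dots> = (\<integral>\<^sup>+a. (\<integral>\<^sup>+r. h a r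
      \<partial>distr lborel borel (\<lambda>p :: real \<times> real. sqrt (a\<^sup>2 + (norm p)\<^sup>2))) \<partial>lborel)"
  proof (rule nn_integral_cong, rule nn_integral_distr[symmetric])
    fix a :: real
    show "(\<lambda>p :: real \<times> real. sqrt (a\<^sup>2 + (norm p)\<^sup>2)) \<in> borel_measurable lborel"
      unfolding measurable_lborel2 by (intro borel_measurable_continuous_onI continuous_intros)
    have "h a \<in> borel_measurable borel"
      by (rule h') simp_all
    then show "h a \<in> borel_measurable (distr lborel borel (\<lambda>p :: real \<times> real. sqrt (a\<^sup>2 + (norm p)\<^sup>2)))"
      by simp
  qed
  also have "\<dots> = (\<integral>\<^sup>+a. (\<integral>\<^sup>+r. h a r * ennreal (2 * pi * r) * indicator {\<bar>a\<bar><..} r \<partial>lborel) \<partial>lborel)"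
    unfolding distr_lborel_sqrt_shifted_norm
    by (intro nn_integral_cong, subst nn_integral_density) (auto intro!: h' simp: mult_ac)
  finally show ?thesis .
qed

section \<open>Laplace transform in time of the Gaussian kernel\<close>

lemma std_normal_cdf_has_real_derivative:
  "(cdf std_normal_distribution has_real_derivative std_normal_density x) (at x)"
proof -
  interpret real_distribution std_normal_distribution
    by (rule real_dist_normal_dist)
  \<comment> \<open>Starting the integral at \<open>x - 1\<close> puts \<open>x\<close> in the
    interior of an interval, so the one-sided fundamental theorem gives a full derivative;
    \<open>?F\<close> equals the distribution function near \<open>x\<close>.\<close>
  let ?F = "\<lambda>y. cdf std_normal_distribution (x - 1) + integral {x - 1..y} std_normal_density"
  have cont: "continuous_on A std_normal_density" for A
    unfolding normal_density_def by (intro continuous_intros) auto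
  have "(?F has_real_derivative (0 + std_normal_density x)) (at x within {x - 1..x + 1})"
    by (intro DERIV_add DERIV_const integral_has_real_derivative cont) auto
  then have D: "(?F has_real_derivative std_normal_density x) (at x)"
    by (simp add: at_within_Icc_at)
  have E: "\<forall>\<^sub>F y in nhds x. ?F y = cdf std_normal_distribution y"
  proof (rule eventually_mono[OF eventually_nhds_in_open[of "{x - 1<..}"]])
    fix y assume y: "y \<in> {x - 1<..}"
    have "cdf std_normal_distribution y - cdf std_normal_distribution (x - 1) =
        measure std_normal_distribution {x - 1<..y}"
      using y by (simp add: cdf_diff_eq)
    also have "\<dots> = (LINT u|std_normal_distribution. indicator {x - 1<..y} u)"
      by simp
    also have "\<dots> = (LINT u:{x - 1<..y}|lborel. std_normal_density u)"
      by (subst integral_density) (auto simp: set_lebesgue_integral_def mult.commute)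
    also have "\<dots> = (LINT u:{x - 1..y}|lborel. std_normal_density u)"
      unfolding set_lebesgue_integral_def
      by (rule integral_cong_AE, simp, simp, rule AE_mp[OF AE_lborel_singleton[of "x - 1"]])
         (auto split: split_indicator)
    also have "\<dots> = integral {x - 1..y} std_normal_density"
      by (intro set_borel_integral_eq_integral borel_integrable_atLeastAtMost' cont)
    finally show "?F y = cdf std_normal_distribution y" by simp
  qed auto
  show ?thesis
    by (rule iffD1[OF DERIV_cong_ev[OF refl E refl] D])
qed

text \<open>For a nonnegative integrand, the limits of the primitive at both ends already give
  integrability. Only a right limit at \<open>a\<close> is asked for because the integrand used
  below contains \<open>sqrt t\<close> in denominators at 0.\<close>

lemma nn_integral_FTC_greaterThan:
  fixes f :: "real \<Rightarrow> real"
  assumes "\<And>x. a < x \<Longrightarrow> DERIV F x :> f x" "\<And>x. a < x \<Longrightarrow> isCont f x" "\<And>x. a < x \<Longrightarrow> 0 \<le> f x"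
    and "(F \<longlongrightarrow> A) (at_right a)" "(F \<longlongrightarrow> B) at_top"
  shows "(\<integral>\<^sup>+x. ennreal (f x) * indicator {a<..} x \<partial>lborel) = ennreal (B - A)"
proof -
  have "((F \<circ> real_of_ereal) \<longlongrightarrow> A) (at_right (ereal a))" "((F \<circ> real_of_ereal) \<longlongrightarrow> B) (at_left \<infinity>)"
    using assms by (auto simp: ereal_tendsto_simps)
  note * = interval_integral_FTC_nonneg[of "ereal a" \<infinity> F f, OF _ _ _ _ this]
  have int: "set_integrable lborel {a<..} f" and eq: "(LINT x:{a<..}|lborel. f x) = B - A"
    using * assms by (auto simp: einterval_eq interval_integral_to_infinity_eq)
  have "(\<integral>\<^sup>+x. ennreal (f x) * indicator {a<..} x \<partial>lborel) =
      (\<integral>\<^sup>+x. ennreal (indicator {a<..} x *\<^sub>R f x) \<partial>lborel)"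
    by (intro nn_integral_cong) (auto split: split_indicator)
  also have "\<dots> = ennreal (LINT x:{a<..}|lborel. f x)"
    using int assms(3) unfolding set_integrable_def set_lebesgue_integral_def
    by (intro nn_integral_eq_integral) (auto split: split_indicator)
  finally show ?thesis by (simp add: eq)
qed

text \<open>
  With \<open>\<Phi>\<close> the normal distribution function, the integrand has the primitive
  \<open>G(t) = (e^(-sa) \<Phi>(s \<surd>t - a/\<surd>t) + e^(sa) \<Phi>(s \<surd>t + a/\<surd>t)) / s\<close>, because
  \<open>(s \<surd>t \<mp> a/\<surd>t)\<^sup>2 / 2 \<plusminus> s a = s\<^sup>2 t / 2 + a\<^sup>2 / (2 t)\<close>.
\<close>

lemma laplace_transform_normal_density:
  fixes a s :: real
  assumes a: "a > 0" and s: "s > 0"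
  shows "(\<integral>\<^sup>+t. ennreal (exp (- (s\<^sup>2 / 2) * t) * normal_density 0 (sqrt t) a) * indicator {0<..} t \<partial>lborel) =
    ennreal (exp (- s * a) / s)"
proof -
  interpret real_distribution std_normal_distribution
    by (rule real_dist_normal_dist)
  define \<Phi> where "\<Phi> = cdf std_normal_distribution"
  define u where "u = (\<lambda>t. s * sqrt t - a / sqrt t)"
  define v where "v = (\<lambda>t. s * sqrt t + a / sqrt t)"
  define G where "G = (\<lambda>t. (exp (- s * a) * \<Phi> (u t) + exp (s * a) * \<Phi> (v t)) / s)"
  let ?g = "\<lambda>t. exp (- (s\<^sup>2 / 2) * t) * normal_density 0 (sqrt t) a"
  have top: "(\<Phi> \<longlongrightarrow> 1) at_top" and bot: "(\<Phi> \<longlongrightarrow> 0) at_bot"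
    unfolding \<Phi>_def by (rule cdf_lim_at_top_prob cdf_lim_at_bot)+
  have "(\<integral>\<^sup>+t. ennreal (?g t) * indicator {0<..} t \<partial>lborel) =
      ennreal ((exp (- s * a) * 1 + exp (s * a) * 1) / s - (exp (- s * a) * 0 + exp (s * a) * 1) / s)"
  \<comment> \<open>At infinity \<open>u\<close> and \<open>v\<close> both tend to infinity; at 0
    from the right \<open>u\<close> tends to minus infinity and \<open>v\<close> to infinity. Hence
    the \<open>v\<close> terms cancel in the difference of limits and only the \<open>u\<close> term
    survives.\<close>
  proof (rule nn_integral_FTC_greaterThan)
    fix t :: real assume t: "0 < t"
    \<comment> \<open>In terms of \<open>q\<close> all the derivatives and exponents are
      rational.\<close>
    define q where "q = sqrt t"
    have q: "q > 0" and tq: "t = q\<^sup>2" using t by (auto simp: q_def)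
    have qs: "inverse q * s / 2 = s / (2 * q)" "a * inverse q / (2 * (q * q)) = a / (2 * q ^ 3)"
      using q by (simp_all add: divide_simps power3_eq_cube)
    have du: "(u has_real_derivative (s / (2 * q) + a / (2 * q ^ 3))) (at t)"
      unfolding u_def using t
      by (auto intro!: derivative_eq_intros simp: q_def[symmetric] qs) (use q in simp)
    have dv: "(v has_real_derivative (s / (2 * q) - a / (2 * q ^ 3))) (at t)"
      unfolding v_def using t
      by (auto intro!: derivative_eq_intros simp: q_def[symmetric] qs) (use q in simp)
    have d\<Phi>: "((\<lambda>t. \<Phi> (w t)) has_real_derivative std_normal_density (w t) * w') (at t)"
      if "(w has_real_derivative w') (at t)" for w w'
      unfolding \<Phi>_def using DERIV_chain2[OF std_normal_cdf_has_real_derivative that] .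
    have "- s * a + - (u t)\<^sup>2 / 2 = - (s\<^sup>2 / 2) * t + - a\<^sup>2 / (2 * q\<^sup>2)"
        "s * a + - (v t)\<^sup>2 / 2 = - (s\<^sup>2 / 2) * t + - a\<^sup>2 / (2 * q\<^sup>2)"
      using q unfolding u_def v_def by (simp_all add: q_def[symmetric])
        (simp_all add: tq field_simps power2_eq_square)
    then have "exp (- s * a) * exp (- (u t)\<^sup>2 / 2) = exp (- (s\<^sup>2 / 2) * t) * exp (- a\<^sup>2 / (2 * q\<^sup>2))"
        "exp (s * a) * exp (- (v t)\<^sup>2 / 2) = exp (- (s\<^sup>2 / 2) * t) * exp (- a\<^sup>2 / (2 * q\<^sup>2))"
      unfolding exp_add[symmetric] by simp_all
    moreover have "?g t = exp (- (s\<^sup>2 / 2) * t) * exp (- a\<^sup>2 / (2 * q\<^sup>2)) / (sqrt (2 * pi) * q)"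
      using q by (simp add: normal_density_def q_def real_sqrt_mult)
    ultimately have eq: "exp (- s * a) * std_normal_density (u t) = ?g t * q"
        "exp (s * a) * std_normal_density (v t) = ?g t * q"
      using q by (simp_all add: std_normal_density_def)
    have "(G has_real_derivative (exp (- s * a) * (std_normal_density (u t) * (s / (2 * q) + a / (2 * q ^ 3))) +
        exp (s * a) * (std_normal_density (v t) * (s / (2 * q) - a / (2 * q ^ 3)))) / s) (at t)"
      unfolding G_def by (intro DERIV_cdivide DERIV_add DERIV_cmult d\<Phi> du dv)
    \<comment> \<open>Both exponential-times-density products equal \<open>?g t * q\<close>, so the
      terms in \<open>a / (2 * q ^ 3)\<close> cancel and the two terms \<open>s / (2 * q)\<close>
      add up to \<open>s / q\<close>.\<close>
    also have "(exp (- s * a) * (std_normal_density (u t) * (s / (2 * q) + a / (2 * q ^ 3))) +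
        exp (s * a) * (std_normal_density (v t) * (s / (2 * q) - a / (2 * q ^ 3)))) / s = ?g t"
      unfolding mult.assoc[symmetric] eq using q s by (simp add: field_simps)
    finally show "(G has_real_derivative ?g t) (at t)" .
    show "isCont ?g t"
      unfolding normal_density_def using t by (intro continuous_intros) auto
    show "0 \<le> ?g t" by simp
  next
    have "filterlim u at_bot (at_right 0)" "filterlim v at_top (at_right 0)"
        "filterlim u at_top at_top" "filterlim v at_top at_top"
      unfolding u_def v_def using a s by real_asymp+
    then have "((\<lambda>t. \<Phi> (u t)) \<longlongrightarrow> 0) (at_right 0)" "((\<lambda>t. \<Phi> (v t)) \<longlongrightarrow> 1) (at_right 0)"
        "((\<lambda>t. \<Phi> (u t)) \<longlongrightarrow> 1) at_top" "((\<lambda>t. \<Phi> (v t)) \<longlongrightarrow> 1) at_top"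
      by (auto intro: filterlim_compose[OF top] filterlim_compose[OF bot])
    then show "(G \<longlongrightarrow> (exp (- s * a) * 0 + exp (s * a) * 1) / s) (at_right 0)"
        "(G \<longlongrightarrow> (exp (- s * a) * 1 + exp (s * a) * 1) / s) at_top"
      unfolding G_def using s by (intro tendsto_divide tendsto_add tendsto_mult tendsto_const; simp)+
  qed
  then show ?thesis by (simp add: diff_divide_distrib[symmetric])
qed

section \<open>One-dimensional marginals of the Bessel process\<close>

text \<open>Since \<open>norm z = 1\<close>, the Gaussian exponent depends on \<open>w\<close> only
  through \<open>a = z \<bullet> w\<close> and \<open>r = norm w\<close>, and it is affine in
  \<open>a\<close>. The integral over \<open>a\<close> between \<open>- r\<close> and
  \<open>r\<close> is therefore elementary, and its two boundary values are the direct and the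
  reflected normal density.\<close>

lemma nn_integral_norm_shifted_normal:
  fixes z :: "real ^ 3" and F :: "real \<Rightarrow> ennreal"
  assumes z: "norm z = 1" and \<sigma>: "\<sigma> > 0" and F [measurable]: "F \<in> borel_measurable borel"
  shows "(\<integral>\<^sup>+w. F (norm w) * ennreal (\<Prod>i\<in>UNIV. normal_density 0 \<sigma> ((w - z) $ i)) \<partial>lborel) =
    (\<integral>\<^sup>+r. F r * ennreal (r * (normal_density 0 \<sigma> (1 - r) - normal_density 0 \<sigma> (1 + r))) *
      indicator {0<..} r \<partial>lborel)"
proof -
  define c where "c = 1 / sqrt (2 * pi * \<sigma>\<^sup>2)"
  have c: "c > 0" "c\<^sup>2 = 1 / (2 * pi * \<sigma>\<^sup>2)"
    using \<sigma> by (simp_all add: c_def power_divide)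
  define e where "e = (\<lambda>a r. exp (- (r\<^sup>2 - 2 * a + 1) / (2 * \<sigma>\<^sup>2)))"
  have e_pos: "e a r > 0" for a r by (simp add: e_def)
  have nd: "normal_density 0 \<sigma> x = c * exp (- x\<^sup>2 / (2 * \<sigma>\<^sup>2))" for x
    by (simp add: normal_density_def c_def)
  have prod: "(\<Prod>i\<in>UNIV. normal_density 0 \<sigma> ((w - z) $ i)) = c ^ 3 * e (z \<bullet> w) (norm w)" for w
  proof -
    have "(norm w)\<^sup>2 - 2 * (z \<bullet> w) + 1 = (norm (w - z))\<^sup>2"
      using z by (simp add: power2_norm_eq_inner inner_diff inner_commute norm_eq_1)
    also have "\<dots> = (\<Sum>i\<in>UNIV. ((w - z) $ i)\<^sup>2)"
      unfolding power2_norm_eq_inner inner_vec_def by (simp add: power2_eq_square)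
    finally have "(\<Sum>i\<in>UNIV. - ((w - z) $ i)\<^sup>2 / (2 * \<sigma>\<^sup>2)) =
        - ((norm w)\<^sup>2 - 2 * (z \<bullet> w) + 1) / (2 * \<sigma>\<^sup>2)"
      by (simp only: sum_divide_distrib[symmetric] sum_negf)
    then show ?thesis
      by (simp only: nd prod.distrib e_def exp_sum[OF finite, symmetric]) simp
  qed
  have "(\<integral>\<^sup>+w. F (norm w) * ennreal (\<Prod>i\<in>UNIV. normal_density 0 \<sigma> ((w - z) $ i)) \<partial>lborel) =
      (\<integral>\<^sup>+w. F (norm w) * ennreal (c ^ 3 * e (z \<bullet> w) (norm w)) \<partial>lborel)"
    by (simp only: prod)
  also have "\<dots> = (\<integral>\<^sup>+a. (\<integral>\<^sup>+r. F r * ennreal (c ^ 3 * e a r) * ennreal (2 * pi * r) *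
      indicator {\<bar>a\<bar><..} r \<partial>lborel) \<partial>lborel)"
    by (rule nn_integral_radial_axial[OF z]) (simp add: e_def borel_prod[symmetric])
  also have "\<dots> = (\<integral>\<^sup>+r. (\<integral>\<^sup>+a. F r * ennreal (c ^ 3 * e a r) * ennreal (2 * pi * r) *
      indicator {\<bar>a\<bar><..} r \<partial>lborel) \<partial>lborel)"
    by (rule lborel_pair.Fubini') (simp add: e_def greaterThan_def)
  also have "\<dots> = (\<integral>\<^sup>+r. F r * ennreal (r * (normal_density 0 \<sigma> (1 - r) - normal_density 0 \<sigma> (1 + r))) *
      indicator {0<..} r \<partial>lborel)"
  proof (rule nn_integral_cong)
    fix r :: real
    show "(\<integral>\<^sup>+a. F r * ennreal (c ^ 3 * e a r) * ennreal (2 * pi * r) * indicator {\<bar>a\<bar><..} r \<partial>lborel) =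
        F r * ennreal (r * (normal_density 0 \<sigma> (1 - r) - normal_density 0 \<sigma> (1 + r))) * indicator {0<..} r"
    proof (cases "r > 0")
      case True
      have "(\<integral>\<^sup>+a. F r * ennreal (c ^ 3 * e a r) * ennreal (2 * pi * r) * indicator {\<bar>a\<bar><..} r \<partial>lborel) =
          (\<integral>\<^sup>+a. F r * (ennreal (c ^ 3 * e a r * (2 * pi * r)) * indicator {- r..r} a) \<partial>lborel)"
        by (rule nn_integral_cong_AE, rule AE_mp[OF AE_lborel_singleton[of r]],
            rule AE_mp[OF AE_lborel_singleton[of "- r"]])
           (use True c e_pos in \<open>auto split: split_indicator simp: ennreal_mult' mult_ac\<close>)
      also have "\<dots> = F r * (\<integral>\<^sup>+a. ennreal (c ^ 3 * e a r * (2 * pi * r)) * indicator {- r..r} a \<partial>lborel)"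
        by (rule nn_integral_cmult) (simp add: e_def)
      also have "(\<integral>\<^sup>+a. ennreal (c ^ 3 * e a r * (2 * pi * r)) * indicator {- r..r} a \<partial>lborel) =
          ennreal (r * c * e r r - r * c * e (- r) r)"
      \<comment> \<open>The primitive is \<open>r * c * e a r\<close>: one factor
        \<open>c\<^sup>2 = 1 / (2 * pi * \<sigma>\<^sup>2)\<close> turns the weight
        \<open>2 * pi * r\<close> into \<open>r / \<sigma>\<^sup>2\<close>, the constant produced by
        differentiating the exponential.\<close>
      proof (rule nn_integral_FTC_Icc)
        fix a
        have "((\<lambda>a. r * c * e a r) has_real_derivative r * c * (e a r * (1 / \<sigma>\<^sup>2))) (at a)"
          unfolding e_def using \<sigma>
          by (auto intro!: derivative_eq_intros simp: power2_eq_square power4_eq_xxxx)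
        also have "r * c * (e a r * (1 / \<sigma>\<^sup>2)) = c * c\<^sup>2 * e a r * (2 * pi * r)"
          using \<sigma> by (simp add: c(2))
        also have "c * c\<^sup>2 = c ^ 3" by (simp add: power2_eq_square power3_eq_cube)
        finally show "((\<lambda>a. r * c * e a r) has_real_derivative c ^ 3 * e a r * (2 * pi * r)) (at a)" .
        show "0 \<le> c ^ 3 * e a r * (2 * pi * r)"
          using True c e_pos[of a r] by simp
      qed (use True in \<open>auto simp: e_def\<close>)
      \<comment> \<open>At \<open>a = r\<close> and \<open>a = - r\<close> the exponent becomes a
        perfect square, \<open>(1 - r)\<^sup>2\<close> or \<open>(1 + r)\<^sup>2\<close>.\<close>
      also have "r * c * e r r - r * c * e (- r) r =
          r * (normal_density 0 \<sigma> (1 - r) - normal_density 0 \<sigma> (1 + r))"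
        by (simp add: nd e_def power2_eq_square algebra_simps)
      finally show ?thesis using True by simp
    next
      case False
      then show ?thesis by (auto intro!: nn_integral_zero' AE_I2 split: split_indicator)
    qed
  qed
  finally show ?thesis .
qed

lemma measurable_path_space_eval:
  assumes "0 \<le> t"
  shows "(\<lambda>X. X t) \<in> borel_measurable path_space"
  unfolding path_space_def using assms
  by (intro measurable_restrict_space1 measurable_component_singleton) auto

text \<open>Almost surely \<open>B t\<close> is \<open>z\<close> plus a centred Gaussian increment
  of variance \<open>t\<close> per coordinate. Translation invariance of \<open>lborel\<close> moves
  the shift into the density, where the previous radial formula applies.\<close>

lemma nn_integral_bessel3_law:
  assumes P: "bessel3_law 1 P" and t: "t > 0" and F [measurable]: "F \<in> borel_measurable borel"
  shows "(\<integral>\<^sup>+X. F (X t) \<partial>P) = (\<integral>\<^sup>+r. F r *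
    ennreal (r * (normal_density 0 (sqrt t) (1 - r) - normal_density 0 (sqrt t) (1 + r))) *
    indicator {0<..} r \<partial>lborel)"
proof -
  obtain M :: "(real \<Rightarrow> real ^ 3) measure" and B and z :: "real ^ 3"
    where B: "brownian_motion M B z" and z: "norm z = 1"
      and P: "P = distr M path_space (\<lambda>\<omega>. \<lambda>t\<in>{0..}. norm (B t \<omega>))"
    using P unfolding bessel3_law_def by blast
  let ?d = "\<lambda>x :: real ^ 3. \<Prod>i\<in>UNIV. normal_density 0 (sqrt t) (x $ i)"
  have Bt [measurable]: "B t \<in> borel_measurable M" and B0: "AE \<omega> in M. B 0 \<omega> = z"
    using B t by (auto simp: brownian_motion_def)
  have "distributed M lborel (\<lambda>\<omega>. B t \<omega> - B 0 \<omega>)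
      (\<lambda>x. ennreal (\<Prod>i\<in>UNIV. normal_density 0 (sqrt (t - 0)) (x $ i)))"
    using B t unfolding brownian_motion_def by blast
  then have D: "distributed M lborel (\<lambda>\<omega>. B t \<omega> - B 0 \<omega>) (\<lambda>x. ennreal (?d x))"
    by simp
  have "(\<integral>\<^sup>+X. F (X t) \<partial>P) = (\<integral>\<^sup>+\<omega>. F (norm (B t \<omega>)) \<partial>M)"
    unfolding P using t
    by (subst nn_integral_distr[OF measurable_norm_path[OF B]])
       (auto intro: measurable_compose[OF measurable_path_space_eval])
  also have "\<dots> = (\<integral>\<^sup>+\<omega>. F (norm (z + (B t \<omega> - B 0 \<omega>))) \<partial>M)"
    by (rule nn_integral_cong_AE) (use B0 in eventually_elim, simp)
  also have "\<dots> = (\<integral>\<^sup>+x. ennreal (?d x) * F (norm (z + x)) \<partial>lborel)"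
    by (rule distributed_nn_integral[OF D, symmetric]) simp
  also have "\<dots> = (\<integral>\<^sup>+x. F (norm (z + x)) * ennreal (?d ((z + x) - z)) \<partial>lborel)"
    by (simp add: mult.commute)
  also have "\<dots> = (\<integral>\<^sup>+w. F (norm w) * ennreal (?d (w - z)) \<partial>distr lborel borel ((+) z))"
    by (subst nn_integral_distr) simp_all
  also have "\<dots> = (\<integral>\<^sup>+w. F (norm w) * ennreal (?d (w - z)) \<partial>lborel)"
    by (simp only: lborel_distr_plus)
  also have "\<dots> = (\<integral>\<^sup>+r. F r *
      ennreal (r * (normal_density 0 (sqrt t) (1 - r) - normal_density 0 (sqrt t) (1 + r))) *
      indicator {0<..} r \<partial>lborel)"
    using t by (intro nn_integral_norm_shifted_normal z F) simp
  finally show ?thesis .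
qed

text \<open>Nonnegativity of the killed kernel, needed whenever it is placed under
  \<open>ennreal\<close>.\<close>

lemma normal_density_reflected_le:
  assumes "0 \<le> r"
  shows "normal_density 0 \<sigma> (1 + r) \<le> normal_density 0 \<sigma> (1 - r)"
proof -
  have "(1 - r)\<^sup>2 \<le> (1 + r)\<^sup>2"
    using assms by (simp add: power2_eq_square algebra_simps)
  then show ?thesis
    unfolding normal_density_def by (intro mult_left_mono) (auto intro!: divide_right_mono)
qed

text \<open>Passes from the Bochner integral to a nonnegative one suited to Tonelli. The convention
  \<open>1 / 0 = 0\<close> has no effect, because the radial density lives on
  \<open>r > 0\<close>.\<close>

lemma ennreal_bessel_r:
  assumes P: "bessel3_law 1 P" and t: "t > 0" and K: "K > 0"
  shows "ennreal (bessel_r P K t) = (\<integral>\<^sup>+r. ennreal ((1 - K * r) *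
    (normal_density 0 (sqrt t) (1 - r) - normal_density 0 (sqrt t) (1 + r))) *
    indicator {0<..<1 / K} r \<partial>lborel)" (is "_ = ?I")
proof -
  let ?q = "\<lambda>r. normal_density 0 (sqrt t) (1 - r) - normal_density 0 (sqrt t) (1 + r)"
  have q: "0 \<le> ?q r" if "0 \<le> r" for r
    using normal_density_reflected_le[OF that] by simp
  have sets: "sets P = sets path_space"
    using P by (auto simp: bessel3_law_def)
  have "(\<integral>\<^sup>+X. ennreal (max (1 / X t - K) 0) \<partial>P) =
      (\<integral>\<^sup>+r. ennreal (max (1 / r - K) 0) * ennreal (r * ?q r) * indicator {0<..} r \<partial>lborel)"
    by (rule nn_integral_bessel3_law[OF P t]) simp
  also have "\<dots> = ?I"
  proof (rule nn_integral_cong)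
    fix r :: real
    consider "r \<le> 0" | "0 < r" "r < 1 / K" | "0 < r" "1 / K \<le> r" by linarith
    then show "ennreal (max (1 / r - K) 0) * ennreal (r * ?q r) * indicator {0<..} r =
        ennreal ((1 - K * r) * ?q r) * indicator {0<..<1 / K} r"
    proof cases
      case 2
      then have pos: "0 \<le> 1 / r - K" "0 \<le> r * ?q r"
        using K q[of r] by (auto simp: field_simps)
      have "ennreal (max (1 / r - K) 0) * ennreal (r * ?q r) = ennreal ((1 / r - K) * (r * ?q r))"
        using pos by (simp add: ennreal_mult)
      also have "(1 / r - K) * (r * ?q r) = (1 - K * r) * ?q r"
        using 2 by (simp add: left_diff_distrib mult.assoc[symmetric])
      finally show ?thesis using 2 by simp
    next
      case 3
      then have "max (1 / r - K) 0 = 0" using K by (auto simp: field_simps)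
      then show ?thesis using 3 by simp
    qed simp
  qed
  finally have eq: "(\<integral>\<^sup>+X. ennreal (max (1 / X t - K) 0) \<partial>P) = ?I" .
  \<comment> \<open>A normal density of mass 1 dominates the integrand. The resulting finiteness is
    what makes \<open>ennreal\<close> undo \<open>enn2real\<close> at the end.\<close>
  have "?I \<le> (\<integral>\<^sup>+r. ennreal (normal_density 1 (sqrt t) r) \<partial>lborel)"
  proof (rule nn_integral_mono)
    fix r :: real
    have "(1 - K * r) * ?q r \<le> 1 * normal_density 0 (sqrt t) (1 - r)" if "0 < r" "r < 1 / K"
      using that K q[of r] by (intro mult_mono) (auto simp: field_simps)
    moreover have "normal_density 0 (sqrt t) (1 - r) = normal_density 1 (sqrt t) r"
      by (simp add: normal_density_def power2_commute)
    ultimately show "ennreal ((1 - K * r) * ?q r) * indicator {0<..<1 / K} r \<le>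
        ennreal (normal_density 1 (sqrt t) r)"
      by (auto split: split_indicator intro!: ennreal_leI)
  qed
  also have "\<dots> = 1"
    using prob_space.emeasure_space_1[OF prob_space_normal_density[of "sqrt t" 1]] t
    by (simp add: emeasure_density)
  finally have fin: "?I < \<infinity>"
    by (rule order_le_less_trans) simp
  have [measurable]: "(\<lambda>X. X t) \<in> borel_measurable path_space"
    using t by (intro measurable_path_space_eval) simp
  have "(\<lambda>X. max (1 / X t - K) 0) \<in> borel_measurable P"
    unfolding measurable_cong_sets[OF sets refl] by measurable
  then have "bessel_r P K t = enn2real ?I"
    unfolding bessel_r_def eq[symmetric] by (intro integral_eq_nn_integral) auto
  with fin show ?thesis by simp
qed

section \<open>Laplace transform of \<open>bessel_r\<close>\<close>

lemma laplace_transform_killed_kernel: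
  fixes r s :: real
  assumes r: "r > 0" "r \<noteq> 1" and s: "s > 0"
  shows "(\<integral>\<^sup>+t. ennreal (exp (- (s\<^sup>2 / 2) * t) *
      (normal_density 0 (sqrt t) (1 - r) - normal_density 0 (sqrt t) (1 + r))) * indicator {0<..} t \<partial>lborel) =
    ennreal ((exp (- s * \<bar>1 - r\<bar>) - exp (- s * (1 + r))) / s)" (is "?D = _")
proof -
  let ?f = "\<lambda>a t. exp (- (s\<^sup>2 / 2) * t) * normal_density 0 (sqrt t) a"
  let ?g = "\<lambda>t. exp (- (s\<^sup>2 / 2) * t) *
    (normal_density 0 (sqrt t) (1 - r) - normal_density 0 (sqrt t) (1 + r))"
  have abs: "normal_density 0 \<sigma> \<bar>x\<bar> = normal_density 0 \<sigma> x" for \<sigma> x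
    by (simp add: normal_density_def)
  have meas [measurable]: "?f a \<in> borel_measurable borel" for a
    unfolding normal_density_def by measurable
  have [measurable]: "?g \<in> borel_measurable borel"
    unfolding normal_density_def by measurable
  have nonneg: "0 \<le> ?g t" for t
    using normal_density_reflected_le[of r "sqrt t"] r by simp
  \<comment> \<open>Adding the finite transform of the reflected term to both sides postpones
    subtraction in \<open>ennreal\<close> until all the integrals have been evaluated.\<close>
  have "?D + ennreal (exp (- s * (1 + r)) / s) =
      ?D + (\<integral>\<^sup>+t. ennreal (?f (1 + r) t) * indicator {0<..} t \<partial>lborel)"
    using r s by (subst laplace_transform_normal_density) auto
  also have "\<dots> = (\<integral>\<^sup>+t. ennreal (?g t) * indicator {0<..} t + ennreal (?f (1 + r) t) * indicator {0<..} t \<partial>lborel)"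
    by (rule nn_integral_add[symmetric]) measurable
  also have "\<dots> = (\<integral>\<^sup>+t. ennreal (?f \<bar>1 - r\<bar> t) * indicator {0<..} t \<partial>lborel)"
  proof (rule nn_integral_cong)
    fix t :: real
    have "ennreal (?g t) + ennreal (?f (1 + r) t) = ennreal (?g t + ?f (1 + r) t)"
      by (rule ennreal_plus[symmetric, OF nonneg]) simp
    also have "?g t + ?f (1 + r) t = ?f \<bar>1 - r\<bar> t"
      by (simp add: abs algebra_simps)
    finally show "ennreal (?g t) * indicator {0<..} t + ennreal (?f (1 + r) t) * indicator {0<..} t =
        ennreal (?f \<bar>1 - r\<bar> t) * indicator {0<..} t"
      by (simp split: split_indicator)
  qed
  also have "\<dots> = ennreal (exp (- s * \<bar>1 - r\<bar>) / s)"
    using r s by (intro laplace_transform_normal_density) auto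
  finally have "?D + ennreal (exp (- s * (1 + r)) / s) = ennreal (exp (- s * \<bar>1 - r\<bar>) / s)" .
  then have "?D = ennreal (exp (- s * \<bar>1 - r\<bar>) / s) - ennreal (exp (- s * (1 + r)) / s)"
    by (rule subst) (simp add: ennreal_add_diff_cancel_right)
  also have "\<dots> = ennreal ((exp (- s * \<bar>1 - r\<bar>) - exp (- s * (1 + r))) / s)"
    using s by (simp add: ennreal_minus diff_divide_distrib)
  finally show ?thesis .
qed

lemma laplace_transform_bessel_r:
  assumes P: "bessel3_law 1 P" and K: "K > 0" and s: "s > 0"
  shows "(\<integral>\<^sup>+t. ennreal (exp (- (s\<^sup>2 / 2) * t)) * ennreal (bessel_r P K t) * indicator {0<..} t \<partial>lborel) =
    (\<integral>\<^sup>+r. ennreal ((1 - K * r) * ((exp (- s * \<bar>1 - r\<bar>) - exp (- s * (1 + r))) / s)) *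
      indicator {0<..<1 / K} r \<partial>lborel)"
proof -
  let ?q = "\<lambda>t r. normal_density 0 (sqrt t) (1 - r) - normal_density 0 (sqrt t) (1 + r)"
  have q: "0 \<le> ?q t r" if "0 \<le> r" for t r
    using normal_density_reflected_le[OF that] by simp
  have "(\<integral>\<^sup>+t. ennreal (exp (- (s\<^sup>2 / 2) * t)) * ennreal (bessel_r P K t) * indicator {0<..} t \<partial>lborel) =
      (\<integral>\<^sup>+t. (\<integral>\<^sup>+r. ennreal (exp (- (s\<^sup>2 / 2) * t)) * (ennreal ((1 - K * r) * ?q t r) *
        indicator {0<..<1 / K} r) * indicator {0<..} t \<partial>lborel) \<partial>lborel)"
  proof (rule nn_integral_cong)
    fix t :: real
    have [measurable]: "?q t \<in> borel_measurable borel"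
      unfolding normal_density_def by measurable
    show "ennreal (exp (- (s\<^sup>2 / 2) * t)) * ennreal (bessel_r P K t) * indicator {0<..} t =
      (\<integral>\<^sup>+r. ennreal (exp (- (s\<^sup>2 / 2) * t)) * (ennreal ((1 - K * r) * ?q t r) *
        indicator {0<..<1 / K} r) * indicator {0<..} t \<partial>lborel)"
      by (cases "t > 0") (simp_all add: ennreal_bessel_r[OF P _ K] nn_integral_cmult)
  qed
  also have "\<dots> = (\<integral>\<^sup>+r. (\<integral>\<^sup>+t. ennreal (exp (- (s\<^sup>2 / 2) * t)) * (ennreal ((1 - K * r) * ?q t r) *
        indicator {0<..<1 / K} r) * indicator {0<..} t \<partial>lborel) \<partial>lborel)"
    by (rule lborel_pair.Fubini') (simp add: normal_density_def)
  also have "\<dots> = (\<integral>\<^sup>+r. ennreal ((1 - K * r) * ((exp (- s * \<bar>1 - r\<bar>) - exp (- s * (1 + r))) / s)) *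
      indicator {0<..<1 / K} r \<partial>lborel)"
  \<comment> \<open>The null point \<open>r = 1\<close> is removed, since there the direct density
    sits at distance 0 and \<open>laplace_transform_normal_density\<close> requires a positive
    distance.\<close>
  proof (rule nn_integral_cong_AE, rule AE_mp[OF AE_lborel_singleton[of 1]], rule AE_I2, rule impI)
    fix r :: real
    assume r1: "r \<noteq> 1"
    show "(\<integral>\<^sup>+t. ennreal (exp (- (s\<^sup>2 / 2) * t)) * (ennreal ((1 - K * r) * ?q t r) *
        indicator {0<..<1 / K} r) * indicator {0<..} t \<partial>lborel) =
      ennreal ((1 - K * r) * ((exp (- s * \<bar>1 - r\<bar>) - exp (- s * (1 + r))) / s)) * indicator {0<..<1 / K} r"
    proof (cases "r \<in> {0<..<1 / K}")
      case True
      then have r: "0 < r" "0 \<le> 1 - K * r"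
        using K by (auto simp: field_simps)
      have [measurable]: "(\<lambda>t. exp (- (s\<^sup>2 / 2) * t) * ?q t r) \<in> borel_measurable borel"
        unfolding normal_density_def by measurable
      have "(\<integral>\<^sup>+t. ennreal (exp (- (s\<^sup>2 / 2) * t)) * (ennreal ((1 - K * r) * ?q t r) *
          indicator {0<..<1 / K} r) * indicator {0<..} t \<partial>lborel) =
        (\<integral>\<^sup>+t. ennreal (1 - K * r) * (ennreal (exp (- (s\<^sup>2 / 2) * t) * ?q t r) * indicator {0<..} t) \<partial>lborel)"
        using True r q[of r]
        by (intro nn_integral_cong) (simp add: ennreal_mult ennreal_mult' mult_ac)
      also have "\<dots> = ennreal (1 - K * r) * ennreal ((exp (- s * \<bar>1 - r\<bar>) - exp (- s * (1 + r))) / s)"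
        by (subst nn_integral_cmult, measurable) (simp only: laplace_transform_killed_kernel[OF r(1) r1 s])
      also have "\<dots> = ennreal ((1 - K * r) * ((exp (- s * \<bar>1 - r\<bar>) - exp (- s * (1 + r))) / s))"
        using r by (intro ennreal_mult'[symmetric]) simp
      finally show ?thesis
        using True by simp
    qed simp
  qed
  finally show ?thesis .
qed

lemma nn_integral_exp_bessel_r_density:
  fixes K s :: real and Lam :: "'a \<Rightarrow> real"
  assumes P: "bessel3_law 1 P" and K: "K > 0" and s: "s > 0"
    and D: "distributed M lborel Lam (\<lambda>t. ennreal (3 * K\<^sup>2 * bessel_r P K t) * indicator {0..} t)"
  shows "(\<integral>\<^sup>+\<omega>. ennreal (exp (- (s\<^sup>2 / 2) * Lam \<omega>)) \<partial>M) = ennreal (3 * K\<^sup>2) *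
    (\<integral>\<^sup>+r. ennreal ((1 - K * r) * ((exp (- s * \<bar>1 - r\<bar>) - exp (- s * (1 + r))) / s)) *
      indicator {0<..<1 / K} r \<partial>lborel)"
proof -
  let ?d = "\<lambda>t. ennreal (3 * K\<^sup>2 * bessel_r P K t) * indicator {0..} t"
  have [measurable]: "?d \<in> borel_measurable borel"
    using distributed_borel_measurable[OF D] by simp
  \<comment> \<open>Measurability of \<open>bessel_r\<close> in time is read off from the density in
    \<open>D\<close> by dividing out the constant.\<close>
  have "ennreal (1 / (3 * K\<^sup>2)) * ?d t * indicator {0<..} t = ennreal (bessel_r P K t) * indicator {0<..} t" for t
  proof -
    have "ennreal (1 / (3 * K\<^sup>2)) * ennreal (3 * K\<^sup>2 * bessel_r P K t) =
        ennreal (1 / (3 * K\<^sup>2) * (3 * K\<^sup>2 * bessel_r P K t))"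
      by (rule ennreal_mult'[symmetric]) simp
    also have "1 / (3 * K\<^sup>2) * (3 * K\<^sup>2 * bessel_r P K t) = bessel_r P K t"
      using K by simp
    finally show ?thesis
      by (simp only: mult.assoc[symmetric]) (simp split: split_indicator)
  qed
  moreover have "(\<lambda>t. ennreal (1 / (3 * K\<^sup>2)) * ?d t * indicator {0<..} t) \<in> borel_measurable borel"
    by measurable
  ultimately have [measurable]: "(\<lambda>t. ennreal (bessel_r P K t) * indicator {0<..} t) \<in> borel_measurable borel"
    by simp
  have "(\<integral>\<^sup>+\<omega>. ennreal (exp (- (s\<^sup>2 / 2) * Lam \<omega>)) \<partial>M) =
      (\<integral>\<^sup>+t. ennreal (3 * K\<^sup>2 * bessel_r P K t) * indicator {0..} t * ennreal (exp (- (s\<^sup>2 / 2) * t)) \<partial>lborel)"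
    by (rule distributed_nn_integral[OF D, symmetric]) simp
  also have "\<dots> = (\<integral>\<^sup>+t. ennreal (3 * K\<^sup>2) * (ennreal (exp (- (s\<^sup>2 / 2) * t)) *
      (ennreal (bessel_r P K t) * indicator {0<..} t)) \<partial>lborel)"
  proof (rule nn_integral_cong_AE, rule AE_mp[OF AE_lborel_singleton[of 0]], rule AE_I2, rule impI)
    fix t :: real
    assume "t \<noteq> 0"
    moreover have "ennreal (3 * K\<^sup>2 * bessel_r P K t) = ennreal (3 * K\<^sup>2) * ennreal (bessel_r P K t)"
      by (rule ennreal_mult') simp
    ultimately show "?d t * ennreal (exp (- (s\<^sup>2 / 2) * t)) = ennreal (3 * K\<^sup>2) *
        (ennreal (exp (- (s\<^sup>2 / 2) * t)) * (ennreal (bessel_r P K t) * indicator {0<..} t))"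
      by (cases "t > 0") (simp_all add: mult_ac del: ennreal_mult')
  qed
  also have "\<dots> = ennreal (3 * K\<^sup>2) * (\<integral>\<^sup>+t. ennreal (exp (- (s\<^sup>2 / 2) * t)) *
      (ennreal (bessel_r P K t) * indicator {0<..} t) \<partial>lborel)"
    by (rule nn_integral_cmult) measurable
  finally show ?thesis
    using laplace_transform_bessel_r[OF P K s] by (simp add: mult.assoc)
qed

section \<open>Closed form of the resolvent integral for \<open>K \<ge> 1\<close>\<close>

text \<open>As \<open>1 / K \<le> 1\<close>, every \<open>r\<close> in the range lies below 1. The
  absolute value thus opens with one sign and the kernel is a single hyperbolic sine.\<close>

lemma nn_integral_killed_resolvent:
  fixes K s :: real
  assumes K: "K \<ge> 1" and s: "s > 0"
  shows "(\<integral>\<^sup>+r. ennreal ((1 - K * r) * ((exp (- s * \<bar>1 - r\<bar>) - exp (- s * (1 + r))) / s)) *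
      indicator {0<..<1 / K} r \<partial>lborel) =
    ennreal (2 / s\<^sup>2 * exp (- s) * (sinh (s * (1 / K)) / (s * (1 / K)) - 1))"
proof -
  let ?f = "\<lambda>r. (1 - K * r) * (2 * exp (- s) * sinh (s * r) / s)"
  \<comment> \<open>Integration by parts of \<open>(1 - K * r) * sinh (s * r)\<close>.\<close>
  let ?G = "\<lambda>r. 2 * exp (- s) / s * ((1 - K * r) * cosh (s * r) / s + K * sinh (s * r) / s\<^sup>2)"
  have eq: "(exp (- s * \<bar>1 - r\<bar>) - exp (- s * (1 + r))) / s = 2 * exp (- s) * sinh (s * r) / s"
    if "r \<in> {0<..<1 / K}" for r
  proof -
    have "1 * r \<le> K * r"
      using that K by (intro mult_right_mono) auto
    moreover have "K * r < 1"
      using that K by (simp add: field_simps)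
    ultimately have "r < 1" by simp
    then have "exp (- s * \<bar>1 - r\<bar>) = exp (- s) * exp (s * r)" "exp (- s * (1 + r)) = exp (- s) * exp (- (s * r))"
      by (simp_all add: exp_add[symmetric] algebra_simps)
    then show ?thesis
      using s by (simp add: sinh_field_def field_simps)
  qed
  have "(\<integral>\<^sup>+r. ennreal ((1 - K * r) * ((exp (- s * \<bar>1 - r\<bar>) - exp (- s * (1 + r))) / s)) *
      indicator {0<..<1 / K} r \<partial>lborel) = (\<integral>\<^sup>+r. ennreal (?f r) * indicator {0..1 / K} r \<partial>lborel)"
  proof (rule nn_integral_cong_AE, rule AE_mp[OF AE_lborel_singleton[of 0]],
      rule AE_mp[OF AE_lborel_singleton[of "1 / K"]], rule AE_I2, intro impI)
    fix r :: real
    assume "r \<noteq> 0" "r \<noteq> 1 / K"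
    then show "ennreal ((1 - K * r) * ((exp (- s * \<bar>1 - r\<bar>) - exp (- s * (1 + r))) / s)) *
        indicator {0<..<1 / K} r = ennreal (?f r) * indicator {0..1 / K} r"
      by (cases "r \<in> {0<..<1 / K}") (simp_all only: eq, auto split: split_indicator)
  qed
  also have "\<dots> = ennreal (?G (1 / K) - ?G 0)"
  proof (rule nn_integral_FTC_Icc[where F = ?G])
    fix r assume "r \<in> {0..1 / K}"
    then have r: "0 \<le> r" "r \<le> 1 / K" by auto
    then have "0 \<le> 1 - K * r"
      using K by (auto simp: field_simps)
    then show "0 \<le> ?f r"
      using r s by simp
    have "(?G has_real_derivative 2 * exp (- s) / s * ((- K * cosh (s * r) + (1 - K * r) * (sinh (s * r) * s)) / s +
        K * (cosh (s * r) * s) / s\<^sup>2)) (at r)"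
      using s by (auto intro!: derivative_eq_intros simp: field_simps power2_eq_square power4_eq_xxxx)
    also have "2 * exp (- s) / s * ((- K * cosh (s * r) + (1 - K * r) * (sinh (s * r) * s)) / s +
        K * (cosh (s * r) * s) / s\<^sup>2) = ?f r"
      using s by (simp add: field_simps power2_eq_square)
    finally show "(?G has_real_derivative ?f r) (at r)" .
  qed (use K s in \<open>auto intro!: borel_measurable_continuous_onI continuous_intros\<close>)
  also have "?G (1 / K) - ?G 0 = 2 / s\<^sup>2 * exp (- s) * (sinh (s * (1 / K)) / (s * (1 / K)) - 1)"
    using K s by (simp add: field_simps power2_eq_square)
  finally show ?thesis .
qed

section \<open>Exclusion of \<open>K < 1\<close>\<close>

text \<open>The bound is uniform in \<open>s\<close>, so it survives the limit as \<open>s\<close>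
  tends to 0, which recovers the total mass.\<close>

lemma nn_integral_killed_resolvent_le:
  fixes K s :: real
  assumes K: "0 < K" "K < 1" and s: "s > 0"
  shows "(\<integral>\<^sup>+r. ennreal ((1 - K * r) * ((exp (- s * \<bar>1 - r\<bar>) - exp (- s * (1 + r))) / s)) *
      indicator {0<..<1 / K} r \<partial>lborel) \<le> ennreal (1 / K - 1 + K / 3)"
proof -
  \<comment> \<open>\<open>2 min 1 r\<close> is the Green function of Brownian motion killed at 0, the limit as \<open>s\<close> tends to 0.\<close>
  have bound: "(exp (- s * \<bar>1 - r\<bar>) - exp (- s * (1 + r))) / s \<le> 2 * min 1 r" if "r > 0" for r
  proof -
    \<comment> \<open>The two exponents differ by \<open>2 * s * min 1 r\<close>; then
      \<open>1 - exp (- x) \<le> x\<close> applies.\<close>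
    have "exp (- s * \<bar>1 - r\<bar>) - exp (- s * (1 + r)) =
        exp (- s * \<bar>1 - r\<bar>) * (1 - exp (- (s * (2 * min 1 r))))"
      using that by (simp add: right_diff_distrib exp_add[symmetric] algebra_simps min_def abs_if)
    also have "\<dots> \<le> 1 * (s * (2 * min 1 r))"
      using s that exp_ge_add_one_self[of "- (s * (2 * min 1 r))"]
      by (intro mult_mono) (auto simp: mult_nonneg_nonneg)
    finally show ?thesis using s by (simp add: field_simps)
  qed
  have "(\<integral>\<^sup>+r. ennreal ((1 - K * r) * ((exp (- s * \<bar>1 - r\<bar>) - exp (- s * (1 + r))) / s)) *
      indicator {0<..<1 / K} r \<partial>lborel) \<le>
      (\<integral>\<^sup>+r. ennreal ((1 - K * r) * (2 * r)) * indicator {0..1} r +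
        ennreal ((1 - K * r) * 2) * indicator {1..1 / K} r \<partial>lborel)"
  \<comment> \<open>The Green function changes form at \<open>r = 1\<close>. That point is counted
    in both pieces, which is harmless for an upper bound.\<close>
  proof (rule nn_integral_mono)
    fix r :: real
    show "ennreal ((1 - K * r) * ((exp (- s * \<bar>1 - r\<bar>) - exp (- s * (1 + r))) / s)) * indicator {0<..<1 / K} r
      \<le> ennreal ((1 - K * r) * (2 * r)) * indicator {0..1} r + ennreal ((1 - K * r) * 2) * indicator {1..1 / K} r"
    proof (cases "r \<in> {0<..<1 / K}")
      case True
      then have "0 \<le> 1 - K * r" using K by (auto simp: field_simps)
      then have "(1 - K * r) * ((exp (- s * \<bar>1 - r\<bar>) - exp (- s * (1 + r))) / s) \<le> (1 - K * r) * (2 * min 1 r)"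
        using True by (intro mult_left_mono bound) auto
      then have "ennreal ((1 - K * r) * ((exp (- s * \<bar>1 - r\<bar>) - exp (- s * (1 + r))) / s))
          \<le> ennreal ((1 - K * r) * (2 * min 1 r))"
        by (rule ennreal_leI)
      also have "ennreal ((1 - K * r) * (2 * min 1 r)) \<le>
          ennreal ((1 - K * r) * (2 * r)) * indicator {0..1} r + ennreal ((1 - K * r) * 2) * indicator {1..1 / K} r"
        using True by (cases "r \<le> 1") (auto simp: min_def intro: add_increasing2)
      finally show ?thesis using True by simp
    qed simp
  qed
  also have "\<dots> = (\<integral>\<^sup>+r. ennreal ((1 - K * r) * (2 * r)) * indicator {0..1} r \<partial>lborel) +
      (\<integral>\<^sup>+r. ennreal ((1 - K * r) * 2) * indicator {1..1 / K} r \<partial>lborel)"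
    by (rule nn_integral_add) measurable
  also have "(\<integral>\<^sup>+r. ennreal ((1 - K * r) * (2 * r)) * indicator {0..1} r \<partial>lborel) =
      ennreal ((1\<^sup>2 - 2 * K * 1 ^ 3 / 3) - (0\<^sup>2 - 2 * K * 0 ^ 3 / 3))"
  proof (rule nn_integral_FTC_Icc[where F = "\<lambda>r. r\<^sup>2 - 2 * K * r ^ 3 / 3"])
    fix r :: real assume r: "r \<in> {0..1}"
    have "K * r \<le> 1 * 1" using K r by (intro mult_mono) auto
    then show "0 \<le> (1 - K * r) * (2 * r)" using r by simp
    show "((\<lambda>r. r\<^sup>2 - 2 * K * r ^ 3 / 3) has_real_derivative (1 - K * r) * (2 * r)) (at r)"
      by (auto intro!: derivative_eq_intros simp: algebra_simps power2_eq_square)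
  qed simp_all
  also have "(\<integral>\<^sup>+r. ennreal ((1 - K * r) * 2) * indicator {1..1 / K} r \<partial>lborel) =
      ennreal ((2 * (1 / K) - K * (1 / K)\<^sup>2) - (2 * 1 - K * 1\<^sup>2))"
  proof (rule nn_integral_FTC_Icc[where F = "\<lambda>r. 2 * r - K * r\<^sup>2"])
    fix r :: real assume r: "r \<in> {1..1 / K}"
    then show "0 \<le> (1 - K * r) * 2" using K by (simp add: field_simps)
    show "((\<lambda>r. 2 * r - K * r\<^sup>2) has_real_derivative (1 - K * r) * 2) (at r)"
      by (auto intro!: derivative_eq_intros simp: algebra_simps)
  qed (use K in auto)
  also have "ennreal ((1\<^sup>2 - 2 * K * 1 ^ 3 / 3) - (0\<^sup>2 - 2 * K * 0 ^ 3 / 3)) +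
      ennreal ((2 * (1 / K) - K * (1 / K)\<^sup>2) - (2 * 1 - K * 1\<^sup>2)) = ennreal (1 / K - 1 + K / 3)"
  proof -
    \<comment> \<open>The second piece contributes \<open>1 / K - 2 + K\<close>; its sign must be
      known before the sum can be taken inside \<open>ennreal\<close>.\<close>
    have "2 \<le> K + 1 / K"
    proof -
      have "0 \<le> (1 - K)\<^sup>2 / K" using K by simp
      also have "(1 - K)\<^sup>2 / K = K + 1 / K - 2" using K by (simp add: field_simps power2_eq_square)
      finally show ?thesis by simp
    qed
    then have "ennreal (1 - 2 * K / 3) + ennreal (1 / K - 2 + K) = ennreal ((1 - 2 * K / 3) + (1 / K - 2 + K))"
      using K by (intro ennreal_plus[symmetric]) auto
    moreover have "(1\<^sup>2 - 2 * K * 1 ^ 3 / 3) - (0\<^sup>2 - 2 * K * 0 ^ 3 / 3) = 1 - 2 * K / 3"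
        "(2 * (1 / K) - K * (1 / K)\<^sup>2) - (2 * 1 - K * 1\<^sup>2) = 1 / K - 2 + K"
        "(1 - 2 * K / 3) + (1 / K - 2 + K) = 1 / K - 1 + K / 3"
      using K by (simp_all add: power2_eq_square)
    ultimately show ?thesis by (simp only:)
  qed
  finally show ?thesis .
qed

text \<open>
  For \<open>K < 1\<close> the function \<open>3 K\<^sup>2 r_K\<close> is not a probability density: its mass is at most
  \<open>1 - (1 - K)\<^sup>3\<close>. So the theorem is vacuous there, although its formula does not hold.
\<close>

lemma bessel_r_density_imp_ge_1:
  fixes K :: real and Lam :: "'a \<Rightarrow> real"
  assumes P: "bessel3_law 1 P" and K: "K > 0" and M: "prob_space M"
    and D: "distributed M lborel Lam (\<lambda>t. ennreal (3 * K\<^sup>2 * bessel_r P K t) * indicator {0..} t)"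
  shows "K \<ge> 1"
proof (rule ccontr)
  assume "\<not> K \<ge> 1"
  then have K1: "K < 1" by simp
  interpret prob_space M by fact
  define m where "m = 3 * K\<^sup>2 * (1 / K - 1 + K / 3)"
  have "1 - m = (1 - K) ^ 3"
    using K by (simp add: m_def field_simps power2_eq_square power3_eq_cube)
  then have m: "m < 1"
    using K1 by (metis diff_gt_0_iff_gt zero_less_power)
  have [measurable]: "Lam \<in> borel_measurable M"
    using distributed_measurable[OF D] by simp
  \<comment> \<open>Laplace parameters with \<open>s = 1 / (n + 1)\<close>: the integrands tend to
    1, so Fatou's lemma bounds the total mass 1 by \<open>m < 1\<close>, a contradiction.\<close>
  let ?u = "\<lambda>n \<omega>. ennreal (exp (- ((1 / real (Suc n))\<^sup>2 / 2) * Lam \<omega>))"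
  have le: "(\<integral>\<^sup>+\<omega>. ?u n \<omega> \<partial>M) \<le> ennreal m" for n
  proof -
    have "(\<integral>\<^sup>+\<omega>. ?u n \<omega> \<partial>M) \<le> ennreal (3 * K\<^sup>2) * ennreal (1 / K - 1 + K / 3)"
      by (subst nn_integral_exp_bessel_r_density[OF P K _ D], simp)
         (intro mult_left_mono nn_integral_killed_resolvent_le K K1, auto)
    also have "\<dots> = ennreal m"
      using K by (simp add: m_def ennreal_mult')
    finally show ?thesis .
  qed
  have "liminf (\<lambda>n. ?u n \<omega>) = 1" for \<omega>
  proof (rule lim_imp_Liminf)
    have "(\<lambda>n. 1 / real (Suc n)) \<longlonglongrightarrow> 0"
      by real_asymp
    then have "(\<lambda>n. exp (- ((1 / real (Suc n))\<^sup>2 / 2) * Lam \<omega>)) \<longlonglongrightarrow> exp (- (0\<^sup>2 / 2) * Lam \<omega>)"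
      by (intro tendsto_intros) auto
    then show "(\<lambda>n. ?u n \<omega>) \<longlonglongrightarrow> 1"
      using tendsto_ennrealI by fastforce
  qed simp
  then have "1 = (\<integral>\<^sup>+\<omega>. liminf (\<lambda>n. ?u n \<omega>) \<partial>M)"
    by (simp add: emeasure_space_1)
  also have "\<dots> \<le> liminf (\<lambda>n. \<integral>\<^sup>+\<omega>. ?u n \<omega> \<partial>M)"
    by (rule nn_integral_liminf) measurable
  also have "\<dots> \<le> liminf (\<lambda>n. ennreal m)"
    by (intro Liminf_mono always_eventually allI le)
  also have "\<dots> = ennreal m"
    by (simp add: Liminf_const)
  finally show False
    using m by (metis ennreal_1 ennreal_le_iff2 not_le zero_less_one)
qed

section \<open>Assembly of the Laplace transform\<close>

text \<open>Gives the sign of the closed form, which is needed to leave \<open>ennreal\<close>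
  without truncation.\<close>

lemma sinh_ge_self:
  fixes x :: real
  assumes "0 \<le> x"
  shows "x \<le> sinh x"
proof -
  have "sinh 0 - 0 \<le> sinh x - x"
    using assms
  proof (rule DERIV_nonneg_imp_nondecreasing)
    fix y :: real
    have "((\<lambda>x. sinh x - x) has_real_derivative cosh y - 1) (at y)"
      by (auto intro!: derivative_eq_intros)
    then show "\<exists>d. ((\<lambda>x. sinh x - x) has_real_derivative d) (at y) \<and> 0 \<le> d"
      using cosh_real_ge_1[of y] by fastforce
  qed
  then show ?thesis by simp
qed

theorem proposition3:
  fixes K k lam :: real
    and P :: "(real \<Rightarrow> real) measure"
    and M :: "'a measure"
    and Lam :: "'a \<Rightarrow> real"
  assumes "K > 0" and "k = 1 / K"
    and "bessel3_law 1 P"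
    and "prob_space M"
    and "distributed M lborel Lam (\<lambda>t. ennreal (3 * K\<^sup>2 * bessel_r P K t) * indicator {0..} t)"
    and "lam > 0"
  shows "prob_space.expectation M (\<lambda>\<omega>. exp (- lam * Lam \<omega>)) =
    3 / (lam * k\<^sup>2) * exp (- sqrt (2 * lam)) *
      (sinh (sqrt (2 * lam) * k) / (sqrt (2 * lam) * k) - 1)"
proof -
  define s where "s = sqrt (2 * lam)"
  have s: "s > 0" and lam: "s\<^sup>2 / 2 = lam" "s\<^sup>2 = 2 * lam"
    using \<open>lam > 0\<close> by (simp_all add: s_def)
  let ?R = "2 / s\<^sup>2 * exp (- s) * (sinh (s * k) / (s * k) - 1)"
  \<comment> \<open>This is where the assumption that \<open>Lam\<close> has the stated function as
    its density selects the range of the closed form.\<close>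
  have K: "K \<ge> 1"
    using bessel_r_density_imp_ge_1 assms by blast
  have "0 < s * k"
    using s K \<open>k = 1 / K\<close> by simp
  then have "1 \<le> sinh (s * k) / (s * k)"
    using sinh_ge_self[of "s * k"] by (simp add: le_divide_eq)
  then have R: "0 \<le> ?R" by simp
  have [measurable]: "Lam \<in> borel_measurable M"
    using distributed_measurable[OF assms(5)] by simp
  have "(\<integral>\<^sup>+\<omega>. ennreal (exp (- lam * Lam \<omega>)) \<partial>M) = ennreal (3 * K\<^sup>2) * ennreal ?R"
    using nn_integral_exp_bessel_r_density[OF assms(3,1) s assms(5)]
    by (simp only: lam(1) nn_integral_killed_resolvent[OF K s] \<open>k = 1 / K\<close>)
  also have "\<dots> = ennreal (3 * K\<^sup>2 * ?R)"
    using R by (intro ennreal_mult[symmetric]) auto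
  finally have eq: "(\<integral>\<^sup>+\<omega>. ennreal (exp (- lam * Lam \<omega>)) \<partial>M) = ennreal (3 * K\<^sup>2 * ?R)" .
  have "(\<integral>\<omega>. exp (- lam * Lam \<omega>) \<partial>M) = enn2real (\<integral>\<^sup>+\<omega>. ennreal (exp (- lam * Lam \<omega>)) \<partial>M)"
    by (intro integral_eq_nn_integral) auto
  also have "\<dots> = 3 * K\<^sup>2 * ?R"
    unfolding eq by (rule enn2real_ennreal, rule mult_nonneg_nonneg[OF _ R]) simp
  \<comment> \<open>The constants match because \<open>s\<^sup>2 = 2 * lam\<close> and
    \<open>K\<^sup>2 = 1 / k\<^sup>2\<close>.\<close>
  also have "\<dots> = 3 / (lam * k\<^sup>2) * exp (- s) * (sinh (s * k) / (s * k) - 1)"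
    using K by (simp add: lam(2) \<open>k = 1 / K\<close> power_divide)
  finally show ?thesis
    unfolding s_def .
qed

end
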